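(* For every integer $n\geqslant 0$ the following hold. (i) $\displaystyle Q_0(n) = pod(n)+2 \sum_{k=1}^{\infty} (-1)^{k}\, pod\big(n-4k^2\big)$. (ii) $\displaystyle Q_2(n) = \sum_{k=0}^{\infty} (-1)^{k(k+1)/2}\, pod\big(n-k(k+1)\big)$.
   Context: A partition of $n$ is a nonincreasing sequence of positive integers (called parts) with sum $n$; the empty partition is the only partition of $0$. For $k\in\{0,2\}$, $Q_k(n)$ is the number of partitions of $n$ into distinct parts none of which is congruent to $k$ modulo $4$. $pod(n)$ is the number of partitions of $n$ in which odd parts are distinct and even parts are unrestricted; $pod(0)=1$ and $pod(x)=0$ if $x$ is not a nonnegative integer (so the sums are finite). *)

theory Defs
  imports "HOL-Analysis.Infinite_Sum" "HOL-Number_Theory.Cong"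
begin

definition partitions :: "nat \<Rightarrow> nat list set" where
  "partitions n = {xs. sorted_wrt (\<ge>) xs \<and> (\<forall>p\<in>set xs. 0 < p) \<and> sum_list xs = n}"

definition Q :: "nat \<Rightarrow> nat \<Rightarrow> nat" where
  "Q k n = card {xs \<in> partitions n. distinct xs \<and> (\<forall>p\<in>set xs. \<not> [p = k] (mod 4))}"

text \<open>The argument is an integer so that differences \<open>n - m\<close> with \<open>n < m\<close> are not truncated to \<open>0\<close>.\<close>

definition pod :: "int \<Rightarrow> nat" where
  "pod x = (if x < 0 then 0 else card {xs \<in> partitions (nat x). distinct (filter odd xs)})"

text \<open>The cardinalities above are those of finite sets.\<close>

lemma finite_partitions: "finite (partitions n)"
proof (rule finite_subset)
  show "partitions n \<subseteq> {xs. set xs \<subseteq> {..n} \<and> length xs \<le> n}"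
  proof safe
    fix xs p assume "xs \<in> partitions n" "p \<in> set xs"
    then show "p \<le> n" using member_le_sum_list[of p xs] by (simp add: partitions_def)
  next
    fix xs assume "xs \<in> partitions n"
    moreover have "(\<forall>p\<in>set xs. 0 < p) \<Longrightarrow> length xs \<le> sum_list xs" for xs :: "nat list"
      by (induction xs) auto
    ultimately show "length xs \<le> n" by (auto simp: partitions_def)
  qed
qed (simp add: finite_lists_length_le)

lemma partitions_0: "partitions 0 = {[]}"
proof -
  have "xs = []" if "xs \<in> partitions 0" for xs
    using that by (cases xs) (auto simp: partitions_def)
  then show ?thesis by (auto simp: partitions_def)
qed

lemma pod_0: "pod 0 = 1"
proof -
  have "{xs \<in> partitions 0. distinct (filter odd xs)} = {[]}"
    by (auto simp: partitions_0)
  then show ?thesis by (simp add: pod_def)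
qed

end

theory Submission
  imports Defs "HOL-Computational_Algebra.Formal_Power_Series"
begin

text \<open>
  The generating functions of the two kinds of partitions are the products
  \<open>\<Prod>(1 + X\<^sup>i)\<close> over the \<open>i\<close> with \<open>\<not> [i = k] (mod 4)\<close> for \<open>Q k\<close>, and
  \<open>\<Prod>(1 + X\<^sup>i) / \<Prod>(1 - X\<^sup>j)\<close> over odd \<open>i\<close> and even \<open>j\<close> for \<open>pod\<close>.
  Since \<open>(1 + X\<^sup>j) (1 - X\<^sup>j) = 1 - X\<^bsup>2j\<^esup>\<close>, the quotient of the first by the second is
  \<open>\<Prod>(1 - X\<^bsup>4i\<^esup>) / \<Prod>(1 + X\<^sup>i)\<close>, where the denominator runs over \<open>[i = k] (mod 4)\<close>
  (\<open>Q_gf_eq_pod_gf_mult\<close>). For \<open>k = 0\<close> and \<open>k = 2\<close> this quotient is one of the theta series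
  that Gauss evaluated, at \<open>x = X\<^sup>4\<close> and \<open>y = - X\<^sup>2\<close> respectively:

    \<open>1 + 2 \<Sum>\<^bsub>k \<ge> 1\<^esub> (-1)\<^sup>k x\<^bsup>k\<^sup>2\<^esup> = \<Prod>(1 - x\<^sup>i) / (1 + x\<^sup>i)\<close>,

    \<open>\<Sum>\<^bsub>k \<ge> 0\<^esub> y\<^bsup>k(k+1)/2\<^esup> = \<Prod>(1 - y\<^bsup>2i\<^esup>) / (1 - y\<^bsup>2i-1\<^esup>)\<close>.

  Multiplying the generating function of \<open>pod\<close> by the theta series and comparing coefficients
  gives the two formulas.

  Both theta identities come from one telescoping sum in the manner of Shanks, stated without
  denominators so that it holds in every commutative ring (\<open>shanks_sum_Suc\<close>). It expresses a
  partial sum of the theta series, times the denominator, as a finite sum whose terms beyond the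
  first have high order and whose first term is the numerator. As the identities are finite, all
  infinite products can be replaced by finite ones, and power series are only compared up to a
  given degree.
\<close>

unbundle fps_syntax

section \<open>Gauss's theta series\<close>

definition qpoch :: "'a::comm_ring_1 \<Rightarrow> 'a \<Rightarrow> nat \<Rightarrow> 'a" where
  "qpoch a q n = (\<Prod>i<n. 1 - a * q ^ i)"

lemma qpoch_Suc: "qpoch a q (Suc n) = qpoch a q n * (1 - a * q ^ n)"
  by (simp add: qpoch_def)

text \<open>A polynomial form of \<open>(q;q)\<^sub>n \<Sum>\<^sub>j (a;q)\<^sub>j (b q\<^sup>n)\<^sup>j / (q;q)\<^sub>j\<close>: the quotient
  \<open>(q;q)\<^sub>n / (q;q)\<^sub>j\<close> is written as a product, which avoids division.\<close>

definition shanks_sum :: "'a::comm_ring_1 \<Rightarrow> 'a \<Rightarrow> 'a \<Rightarrow> nat \<Rightarrow> 'a" where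
  "shanks_sum a b q n = (\<Sum>j\<le>n. (b * q ^ n) ^ j * qpoch a q j * (\<Prod>i\<in>{j<..n}. 1 - q ^ i))"

text \<open>The \<open>j\<close>-th terms of \<open>shanks_sum a b q (n + 1)\<close> and of \<open>(1 - b q\<^sup>n) * shanks_sum a b q n\<close> have a
  common factor; their difference is that factor times
  \<open>(1 - q\<^bsup>n+1\<^esup>) q\<^sup>j - (1 - b q\<^sup>n) = b q\<^sup>n (1 - a q\<^sup>j) - (1 - q\<^sup>j)\<close>. This is where \<open>a b = q\<close>
  enters. The factor \<open>1 - a q\<^sup>j\<close> extends the Pochhammer symbol and \<open>1 - q\<^sup>j\<close> extends the other
  product, so that the differences telescope.\<close>

lemma shanks_sum_Suc:
  fixes a b q :: "'a::comm_ring_1"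
  assumes ab: "a * b = q"
  shows "shanks_sum a b q (Suc n) = (1 - b * q ^ n) * shanks_sum a b q n
           + b ^ Suc n * q ^ (n * Suc n) * (1 + q ^ Suc n) * qpoch a q (Suc n)"
proof -
  define G where "G j = (b * q ^ n) ^ j * qpoch a q j * (\<Prod>i\<in>{j..n}. 1 - q ^ i)" for j
  have step: "(b * q ^ Suc n) ^ j * qpoch a q j * (\<Prod>i\<in>{j<..Suc n}. 1 - q ^ i)
        - (1 - b * q ^ n) * ((b * q ^ n) ^ j * qpoch a q j * (\<Prod>i\<in>{j<..n}. 1 - q ^ i))
        = G (Suc j) - G j" if "j \<le> n" for j
  proof -
    define W where "W = (b * q ^ n) ^ j"
    define V where "V = qpoch a q j"
    define F where "F = (\<Prod>i\<in>{j<..n}. 1 - q ^ i)"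
    have "{j<..Suc n} = insert (Suc n) {j<..n}" using that by auto
    then have 1: "(\<Prod>i\<in>{j<..Suc n}. 1 - q ^ i) = (1 - q ^ Suc n) * F"
      by (simp add: F_def)
    have "{j..n} = insert j {j<..n}" using that by auto
    then have 2: "G j = W * V * ((1 - q ^ j) * F)"
      by (simp add: F_def G_def W_def V_def)
    have "{Suc j..n} = {j<..n}" by auto
    then have 3: "G (Suc j) = W * (b * q ^ n) * (V * (1 - a * q ^ j)) * F"
      by (simp add: F_def G_def W_def V_def qpoch_Suc mult_ac)
    have 4: "(b * q ^ Suc n) ^ j = W * q ^ j"
      by (simp add: W_def power_mult_distrib power_mult[symmetric] power_add[symmetric] algebra_simps)
    have 5: "q ^ Suc n = a * b * q ^ n" by (simp add: ab)
    show ?thesis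
      unfolding 1 2 3 4 W_def[symmetric] V_def[symmetric] F_def[symmetric]
      unfolding 5
      by (simp add: algebra_simps)
  qed
  \<comment> \<open>The product in \<open>G 0\<close> contains the factor \<open>1 - q ^ 0\<close>.\<close>
  have G0: "G 0 = 0"
    by (simp add: G_def prod.atLeast_Suc_atMost)
  have Gn: "G (Suc n) = (b * q ^ n) ^ Suc n * qpoch a q (Suc n)"
    by (simp add: G_def)
  have "(\<Sum>j\<le>n. (b * q ^ Suc n) ^ j * qpoch a q j * (\<Prod>i\<in>{j<..Suc n}. 1 - q ^ i))
          - (1 - b * q ^ n) * shanks_sum a b q n = (\<Sum>j\<le>n. G (Suc j) - G j)"
    unfolding shanks_sum_def sum_distrib_left sum_subtractf[symmetric]
    by (intro sum.cong refl step) simp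
  also have "\<dots> = G (Suc n)"
    using sum_telescope[of "\<lambda>j. - G j" n] by (simp add: G0)
  finally have "shanks_sum a b q (Suc n) = (1 - b * q ^ n) * shanks_sum a b q n + G (Suc n)
      + (b * q ^ Suc n) ^ Suc n * qpoch a q (Suc n)"
    by (simp add: shanks_sum_def[of _ _ _ "Suc n"] algebra_simps)
  also have "(b * q ^ Suc n) ^ Suc n = b ^ Suc n * q ^ (n * Suc n) * q ^ Suc n"
  proof -
    have "Suc n * Suc n = n * Suc n + Suc n" by simp
    then show ?thesis
      by (simp only: power_mult_distrib power_mult[symmetric] power_add mult.assoc)
  qed
  also have "G (Suc n) = b ^ Suc n * q ^ (n * Suc n) * qpoch a q (Suc n)"
    by (simp only: Gn power_mult_distrib power_mult)
  finally show ?thesis by (simp add: algebra_simps)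
qed

text \<open>The choice \<open>a = -1\<close>, \<open>b = -q\<close> makes the inhomogeneous term of \<open>shanks_sum_Suc\<close> divisible by
  \<open>qpoch (- q) q (Suc n)\<close>: the factor \<open>i = 0\<close> of \<open>qpoch (- 1) q (Suc n)\<close> is \<open>2\<close>, its other factors
  form \<open>qpoch (- q) q n\<close>, and \<open>1 + q\<^bsup>n+1\<^esup>\<close> is the factor that is missing.\<close>

lemma gauss_squares_finite:
  fixes q :: "'a::comm_ring_1"
  shows "(1 + 2 * (\<Sum>k=1..n. (-1) ^ k * q ^ k\<^sup>2)) * qpoch (- q) q n = shanks_sum (- 1) (- q) q n"
proof (induction n)
  case 0
  then show ?case by (simp add: shanks_sum_def qpoch_def)
next
  case (Suc n)
  have shift: "qpoch (- 1) q (Suc m) = 2 * qpoch (- q) q m" for m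
    by (simp add: qpoch_def prod.lessThan_Suc_shift del: prod.lessThan_Suc)
  have q2: "(- q) ^ Suc n * q ^ (n * Suc n) = (- 1) ^ Suc n * q ^ (Suc n)\<^sup>2"
  proof -
    have "(Suc n)\<^sup>2 = Suc n + n * Suc n" by (simp add: power2_eq_square)
    then show ?thesis by (simp only: power_minus[of q] power_add mult.assoc)
  qed
  have "shanks_sum (- 1) (- q) q (Suc n) = (1 - - q * q ^ n) * shanks_sum (- 1) (- q) q n
      + (- q) ^ Suc n * q ^ (n * Suc n) * (1 + q ^ Suc n) * qpoch (- 1) q (Suc n)"
    by (rule shanks_sum_Suc) simp
  then show ?case
    unfolding q2 shift Suc.IH[symmetric] by (simp add: qpoch_Suc algebra_simps)
qed

text \<open>For \<open>a = b = y\<close> and \<open>q = y\<^sup>2\<close> the Pochhammer symbols on both sides of the recurrence are the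
  same, and each step contributes the two powers of \<open>y\<close> whose exponents are the triangular numbers
  with indices \<open>2n + 1\<close> and \<open>2n + 2\<close>.\<close>

lemma gauss_triangular_finite:
  fixes y :: "'a::comm_ring_1"
  shows "(\<Sum>k\<le>2 * n. y ^ (k * (k + 1) div 2)) * qpoch y (y\<^sup>2) n = shanks_sum y y (y\<^sup>2) n"
proof (induction n)
  case 0
  then show ?case by (simp add: shanks_sum_def qpoch_def)
next
  case (Suc n)
  have e1: "(2 * n + 1) * (2 * n + 2) div 2 = Suc n + 2 * (n * Suc n)"
    and e2: "(2 * n + 2) * (2 * n + 3) div 2 = Suc n + 2 * (n * Suc n) + 2 * Suc n"
  proof -
    have "(2 * n + 1) * (2 * n + 2) = 2 * (Suc n + 2 * (n * Suc n))"
      by (simp add: algebra_simps)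
    then show "(2 * n + 1) * (2 * n + 2) div 2 = Suc n + 2 * (n * Suc n)" by simp
    have "(2 * n + 2) * (2 * n + 3) = 2 * (Suc n + 2 * (n * Suc n) + 2 * Suc n)"
      by (simp add: algebra_simps)
    then show "(2 * n + 2) * (2 * n + 3) div 2 = Suc n + 2 * (n * Suc n) + 2 * Suc n" by simp
  qed
  have "(\<Sum>k\<le>2 * Suc n. y ^ (k * (k + 1) div 2)) = (\<Sum>k\<le>2 * n. y ^ (k * (k + 1) div 2))
      + y ^ ((2 * n + 1) * (2 * n + 2) div 2) + y ^ ((2 * n + 2) * (2 * n + 3) div 2)"
    by (simp add: eval_nat_numeral)
  also have "\<dots> = (\<Sum>k\<le>2 * n. y ^ (k * (k + 1) div 2))
      + y ^ Suc n * (y\<^sup>2) ^ (n * Suc n) * (1 + (y\<^sup>2) ^ Suc n)"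
    unfolding e1 e2
    by (simp only: power_mult[symmetric] power_add distrib_left mult_1_right add.assoc mult.assoc)
  finally have S: "(\<Sum>k\<le>2 * Suc n. y ^ (k * (k + 1) div 2)) = \<dots>" .
  show ?case
    unfolding S shanks_sum_Suc[of y y "y\<^sup>2" n, folded power2_eq_square, OF refl] Suc.IH[symmetric]
    by (simp add: qpoch_Suc algebra_simps)
qed

text \<open>Every term with \<open>j > 0\<close> is a multiple of \<open>b q\<^sup>n\<close>, and the term \<open>j = 0\<close> is the product. Together
  with the two preceding identities this evaluates the theta series modulo \<open>b q\<^sup>n\<close>.\<close>

lemma shanks_sum_cong_prod:
  "b * q ^ n dvd shanks_sum a b q n - (\<Prod>i=1..n. 1 - q ^ i)"
proof -
  have "{0<..n} = {1..n}" by auto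
  then have "shanks_sum a b q n - (\<Prod>i=1..n. 1 - q ^ i)
      = (\<Sum>j\<in>{1..n}. (b * q ^ n) ^ j * qpoch a q j * (\<Prod>i\<in>{j<..n}. 1 - q ^ i))"
    by (simp add: shanks_sum_def atMost_atLeast0 sum.atLeast_Suc_atMost[of 0] qpoch_def)
  also have "b * q ^ n dvd \<dots>"
    by (intro dvd_sum dvd_mult2 dvd_power) auto
  finally show ?thesis .
qed

section \<open>Truncated equality of power series\<close>

definition eq_upto :: "nat \<Rightarrow> int fps \<Rightarrow> int fps \<Rightarrow> bool" where
  "eq_upto n f g \<longleftrightarrow> fps_X ^ Suc n dvd f - g"

lemma fps_X_power_dvd_iff:
  fixes f :: "'a::comm_ring_1 fps"
  shows "fps_X ^ m dvd f \<longleftrightarrow> (\<forall>i<m. f $ i = 0)"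
proof
  assume "fps_X ^ m dvd f"
  then show "\<forall>i<m. f $ i = 0" by (auto simp: fps_X_power_mult_nth elim!: dvdE)
next
  assume "\<forall>i<m. f $ i = 0"
  then have "f = fps_X ^ m * fps_shift m f"
    by (intro fps_ext) (auto simp: fps_X_power_mult_nth)
  then show "fps_X ^ m dvd f" by (metis dvd_triv_left)
qed

lemma eq_upto_iff: "eq_upto n f g \<longleftrightarrow> (\<forall>i\<le>n. f $ i = g $ i)"
  by (auto simp: eq_upto_def fps_X_power_dvd_iff less_Suc_eq_le simp del: power_Suc)

lemma eq_upto_refl [simp]: "eq_upto n f f"
  by (simp add: eq_upto_iff)

lemma eq_upto_sym: "eq_upto n f g \<Longrightarrow> eq_upto n g f"
  by (simp add: eq_upto_iff)

lemma eq_upto_trans [trans]: "eq_upto n f g \<Longrightarrow> eq_upto n g h \<Longrightarrow> eq_upto n f h"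
  by (simp add: eq_upto_iff)

lemma eq_upto_mult:
  assumes "eq_upto n f g" "eq_upto n h k"
  shows "eq_upto n (f * h) (g * k)"
proof -
  have "f * h - g * k = f * (h - k) + (f - g) * k" by (simp add: algebra_simps)
  then show ?thesis using assms by (simp add: eq_upto_def)
qed

lemma eq_upto_prod_superset:
  assumes "finite T" "S \<subseteq> T" "\<And>i. i \<in> T - S \<Longrightarrow> eq_upto n (f i) 1"
  shows "eq_upto n (prod f T) (prod f S)"
proof -
  have "eq_upto n (prod f A) 1" if "finite A" "A \<subseteq> T - S" for A
    using that
  proof (induction A)
    case (insert x A)
    then show ?case using eq_upto_mult[of n "f x" 1 "prod f A" 1] assms(3) by auto
  qed simp
  from this[of "T - S"] have "eq_upto n (prod f (T - S) * prod f S) (1 * prod f S)"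
    using assms by (intro eq_upto_mult) auto
  then show ?thesis using prod.subset_diff[OF assms(2,1), of f] by simp
qed

text \<open>A series with constant term \<open>1\<close> is invertible, even over the integers. This replaces all
  divisions by infinite products.\<close>

lemma eq_upto_cancel:
  assumes "f $ 0 = 1" "eq_upto n (g * f) (h * f)"
  shows "eq_upto n g h"
proof -
  define f' where "f' = fps_right_inverse f 1"
  have "f * f' = 1" unfolding f'_def using assms(1) by (intro fps_right_inverse) auto
  moreover have "eq_upto n ((g * f) * f') ((h * f) * f')"
    using assms(2) by (rule eq_upto_mult) simp
  ultimately show ?thesis by (simp add: mult.assoc)
qed

section \<open>Generating functions of partitions\<close>

text \<open>One family covers both kinds of partitions: parts in \<open>D\<close> are distinct, parts in \<open>R\<close> may
  repeat. The bound \<open>N\<close> on the parts makes the generating functions finite products and is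
  the variable of the recursion.\<close>

definition restricted_partitions :: "nat set \<Rightarrow> nat set \<Rightarrow> nat \<Rightarrow> nat \<Rightarrow> nat list set" where
  "restricted_partitions D R N n =
     {xs \<in> partitions n. (\<forall>p\<in>set xs. p \<le> N \<and> p \<in> D \<union> R) \<and> distinct (filter (\<lambda>p. p \<in> D) xs)}"

definition restricted_gf :: "nat set \<Rightarrow> nat set \<Rightarrow> nat \<Rightarrow> int fps" where
  "restricted_gf D R N = Abs_fps (\<lambda>n. int (card (restricted_partitions D R N n)))"

lemma finite_restricted_partitions: "finite (restricted_partitions D R N n)"
  by (rule finite_subset[OF _ finite_partitions[of n]]) (auto simp: restricted_partitions_def)

text \<open>As partitions are nonincreasing lists, a part \<open>N + 1\<close> stands at the head. What follows it can
  contain \<open>N + 1\<close> again only if \<open>N + 1\<close> may be repeated.\<close>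

lemma restricted_partitions_Suc:
  "restricted_partitions D R (Suc N) n = restricted_partitions D R N n \<union>
     (if Suc N \<in> D \<union> R \<and> Suc N \<le> n
      then (#) (Suc N) ` restricted_partitions D R (if Suc N \<in> D then N else Suc N) (n - Suc N)
      else {})" (is "?L = ?A \<union> ?B")
proof (intro equalityI subsetI)
  fix xs assume xs: "xs \<in> ?L"
  show "xs \<in> ?A \<union> ?B"
  proof (cases "Suc N \<in> set xs")
    case False
    then show ?thesis using xs by (force simp: restricted_partitions_def le_Suc_eq)
  next
    case True
    then obtain x ys where xs_eq: "xs = x # ys" by (cases xs) auto
    have "x = Suc N" using xs True
      by (auto simp: xs_eq restricted_partitions_def partitions_def intro: antisym)
    moreover have "p \<le> N" if "p \<in> set ys" "Suc N \<in> D" for p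
    proof -
      have "p \<le> Suc N" "p \<noteq> Suc N"
        using xs that \<open>x = Suc N\<close> by (auto simp: xs_eq restricted_partitions_def)
      then show ?thesis by simp
    qed
    ultimately show ?thesis using xs
      by (auto simp: xs_eq restricted_partitions_def partitions_def)
  qed
next
  fix xs assume "xs \<in> ?A \<union> ?B"
  then show "xs \<in> ?L"
    by (fastforce simp: restricted_partitions_def partitions_def split: if_splits)
qed

lemma card_restricted_partitions_Suc:
  "card (restricted_partitions D R (Suc N) n) = card (restricted_partitions D R N n) +
     (if Suc N \<in> D \<union> R \<and> Suc N \<le> n
      then card (restricted_partitions D R (if Suc N \<in> D then N else Suc N) (n - Suc N)) else 0)"
proof -
  have "Suc N # ys \<notin> restricted_partitions D R N n" for ys
    by (auto simp: restricted_partitions_def)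
  then have "restricted_partitions D R N n \<inter> (#) (Suc N) ` B = {}" for B by auto
  then show ?thesis
    unfolding restricted_partitions_Suc[of D R N n]
    by (auto simp: card_Un_disjoint finite_restricted_partitions card_image)
qed

lemma restricted_gf_Suc:
  "restricted_gf D R (Suc N) = restricted_gf D R N +
     (if Suc N \<in> D then fps_X ^ Suc N * restricted_gf D R N
      else if Suc N \<in> R then fps_X ^ Suc N * restricted_gf D R (Suc N) else 0)"
  by (rule fps_ext)
     (auto simp: restricted_gf_def card_restricted_partitions_Suc[of D R N] fps_X_power_mult_nth
           simp del: power_Suc)

text \<open>By the recursion, raising the bound to \<open>N + 1\<close> multiplies the generating function by
  \<open>1 + X\<^bsup>N+1\<^esup>\<close> if \<open>N + 1 \<in> D\<close> and divides it by \<open>1 - X\<^bsup>N+1\<^esup>\<close> if \<open>N + 1 \<in> R\<close>.\<close>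

lemma restricted_gf_product:
  assumes "D \<inter> R = {}"
  shows "restricted_gf D R N * (\<Prod>i\<in>{1..N} \<inter> R. 1 - fps_X ^ i) = (\<Prod>i\<in>{1..N} \<inter> D. 1 + fps_X ^ i)"
proof (induction N)
  case 0
  have "restricted_partitions D R 0 n = (if n = 0 then {[]} else {})" for n
  proof -
    have "xs = []" if "xs \<in> restricted_partitions D R 0 n" for xs
      using that by (cases xs) (auto simp: restricted_partitions_def partitions_def)
    then have "restricted_partitions D R 0 n = {xs \<in> {[]}. xs \<in> restricted_partitions D R 0 n}"
      by blast
    also have "\<dots> = (if n = 0 then {[]} else {})"
      by (auto simp: restricted_partitions_def partitions_def)
    finally show ?thesis .
  qed
  then have "restricted_gf D R 0 = 1"
    by (intro fps_ext) (auto simp: restricted_gf_def)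
  then show ?case by simp
next
  case (Suc N)
  have ins: "{1..Suc N} \<inter> A = (if Suc N \<in> A then insert (Suc N) ({1..N} \<inter> A) else {1..N} \<inter> A)"
    for A by (auto simp: le_Suc_eq)
  consider "Suc N \<in> D" "Suc N \<notin> R" | "Suc N \<notin> D" "Suc N \<in> R" | "Suc N \<notin> D" "Suc N \<notin> R"
    using assms by auto
  then show ?case
  proof cases
    case 1
    have "restricted_gf D R (Suc N) = (1 + fps_X ^ Suc N) * restricted_gf D R N"
      using restricted_gf_Suc[of D R N] 1 by (simp add: algebra_simps)
    then show ?thesis using 1 Suc unfolding ins by (simp add: mult.assoc)
  next
    case 2
    have "restricted_gf D R (Suc N) * (1 - fps_X ^ Suc N) = restricted_gf D R N"
      using restricted_gf_Suc[of D R N] 2 by (simp add: algebra_simps)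
    then show ?thesis using 2 Suc unfolding ins by (simp add: mult.assoc[symmetric] del: power_Suc)
  next
    case 3
    then show ?thesis using restricted_gf_Suc[of D R N] Suc unfolding ins by simp
  qed
qed

definition Q_gf :: "nat \<Rightarrow> int fps" where
  "Q_gf k = Abs_fps (\<lambda>n. int (Q k n))"

definition pod_gf :: "int fps" where
  "pod_gf = Abs_fps (\<lambda>n. int (pod (int n)))"

lemma partitions_part_le: "xs \<in> partitions n \<Longrightarrow> p \<in> set xs \<Longrightarrow> p \<le> n"
  using member_le_sum_list[of p xs] by (simp add: partitions_def)

lemma Q_gf_eq_upto:
  assumes "n \<le> N"
  shows "eq_upto n (Q_gf k) (restricted_gf {p. \<not> [p = k] (mod 4)} {} N)"
proof -
  have "{xs \<in> partitions i. distinct xs \<and> (\<forall>p\<in>set xs. \<not> [p = k] (mod 4))}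
      = restricted_partitions {p. \<not> [p = k] (mod 4)} {} N i" if "i \<le> n" for i
  proof -
    have "distinct xs \<longleftrightarrow> distinct (filter (\<lambda>p. \<not> [p = k] (mod 4)) xs)"
      if "\<forall>p\<in>set xs. \<not> [p = k] (mod 4)" for xs
      using that by (metis filter_True)
    moreover have "p \<le> N" if "xs \<in> partitions i" "p \<in> set xs" for xs p
      using partitions_part_le[OF that] \<open>i \<le> n\<close> assms by simp
    ultimately show ?thesis by (auto simp: restricted_partitions_def)
  qed
  then show ?thesis by (simp add: eq_upto_iff Q_gf_def restricted_gf_def Q_def)
qed

lemma pod_gf_eq_upto:
  assumes "n \<le> N"
  shows "eq_upto n pod_gf (restricted_gf {p. odd p} {p. even p} N)"
proof -
  have "{xs \<in> partitions i. distinct (filter odd xs)}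
      = restricted_partitions {p. odd p} {p. even p} N i" if "i \<le> n" for i
    using partitions_part_le that assms by (fastforce simp: restricted_partitions_def)
  then show ?thesis by (simp add: eq_upto_iff pod_gf_def restricted_gf_def pod_def)
qed

section \<open>Dividing the generating functions\<close>

text \<open>Let \<open>K\<close> be the residue class of \<open>k\<close>, let \<open>P A\<close> be the product of \<open>1 + X\<^sup>i\<close> over \<open>i \<in> A\<close>, and let
  \<open>E\<close> be the product of \<open>1 - X\<^sup>i\<close> over even \<open>i\<close>. Up to truncation, multiplying the claim by \<open>P K * E\<close>
  turns its left side into \<open>P UNIV * E\<close> and its right side into \<open>P {p. odd p} * (\<theta> * P K)\<close>. These
  agree because \<open>P {p. even p} * E\<close> is the product of the \<open>1 - X\<^bsup>4i\<^esup>\<close>. The bound \<open>4 * n\<close> is chosen so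
  that the products over residue classes modulo \<open>4\<close> have exactly \<open>n\<close> factors.\<close>

lemma Q_gf_eq_pod_gf_mult:
  assumes theta: "eq_upto n (\<theta> * (\<Prod>i\<in>{1..4*n} \<inter> {i. [i = k] (mod 4)}. 1 + fps_X ^ i))
                            (\<Prod>i=1..n. 1 - fps_X ^ (4 * i))"
  shows "eq_upto n (Q_gf k) (pod_gf * \<theta>)"
proof -
  define N where "N = 4 * n"
  define P where "P A = (\<Prod>i\<in>{1..N} \<inter> A. 1 + fps_X ^ i :: int fps)" for A
  define E where "E = (\<Prod>i\<in>{1..N} \<inter> {i. even i}. 1 - fps_X ^ i :: int fps)"
  define K where "K = {i. [i = k] (mod 4)}"
  have split: "P UNIV = P A * P (- A)" for A
  proof -
    have "{1..N} \<inter> UNIV = ({1..N} \<inter> A) \<union> ({1..N} \<inter> - A)" by auto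
    then show ?thesis unfolding P_def by (subst prod.union_disjoint[symmetric]) auto
  qed
  have Qk: "restricted_gf (- K) {} N * P K = P UNIV"
    using restricted_gf_product[of "- K" "{}" N] split[of K]
    by (simp add: P_def mult.commute)
  have pd: "restricted_gf {p. odd p} {p. even p} N * E = P {p. odd p}"
    using restricted_gf_product[of "{p. odd p}" "{p. even p}" N] by (auto simp: P_def E_def)
  have PE: "P {p. even p} * E = (\<Prod>i=1..2*n. 1 - fps_X ^ (4 * i))"
  proof -
    have "P {p. even p} * E = (\<Prod>i\<in>{1..N} \<inter> {p. even p}. 1 - fps_X ^ (2 * i))"
      unfolding P_def E_def prod.distrib[symmetric]
      by (intro prod.cong) (simp_all add: algebra_simps mult_2_right power_add)
    also have "{1..N} \<inter> {p. even p} = (\<lambda>i. 2 * i) ` {1..2*n}"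
      by (auto simp: N_def image_iff elim!: evenE)
    finally show ?thesis by (simp add: prod.reindex inj_on_def)
  qed
  \<comment> \<open>The surplus factors, with \<open>n < i \<le> 2 * n\<close>, only affect degrees above \<open>4 * n\<close>.\<close>
  have E2: "eq_upto n (P {p. even p} * E) (\<Prod>i=1..n. 1 - fps_X ^ (4 * i))"
    unfolding PE
    by (intro eq_upto_prod_superset) (auto simp: eq_upto_iff fps_X_power_nth)
  have "eq_upto n (Q_gf k * (P K * E)) (restricted_gf (- K) {} N * (P K * E))"
    using Q_gf_eq_upto[of n N k] by (intro eq_upto_mult) (auto simp: N_def K_def Collect_neg_eq)
  also have "restricted_gf (- K) {} N * (P K * E) = P {p. odd p} * (P {p. even p} * E)"
    using Qk split[of "{p. odd p}"] by (simp add: mult.assoc[symmetric] Collect_neg_eq[symmetric])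
  also have "eq_upto n \<dots> (P {p. odd p} * (\<Prod>i=1..n. 1 - fps_X ^ (4 * i)))"
    by (intro eq_upto_mult E2) simp
  also have "eq_upto n \<dots> (P {p. odd p} * (\<theta> * P K))"
    by (intro eq_upto_mult eq_upto_sym[OF theta, folded N_def K_def, folded P_def]) simp
  also have "P {p. odd p} * (\<theta> * P K)
      = restricted_gf {p. odd p} {p. even p} N * (\<theta> * (P K * E))"
    by (simp add: pd[symmetric] mult_ac)
  also have "eq_upto n \<dots> (pod_gf * (\<theta> * (P K * E)))"
    by (intro eq_upto_mult eq_upto_sym[OF pod_gf_eq_upto]) (auto simp: N_def)
  finally have "eq_upto n (Q_gf k * (P K * E)) (pod_gf * \<theta> * (P K * E))"
    by (simp add: mult.assoc)
  moreover have "(P K * E) $ 0 = 1"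
    by (auto simp: P_def E_def fps_prod_nth' fps_X_power_nth intro!: prod.neutral)
  ultimately show ?thesis using eq_upto_cancel by blast
qed

lemma theta_squares_eq_upto:
  "eq_upto n ((1 + 2 * (\<Sum>k=1..n. (-1) ^ k * (fps_X ^ 4) ^ k\<^sup>2))
               * (\<Prod>i\<in>{1..4*n} \<inter> {i. [i = 0] (mod 4)}. 1 + fps_X ^ i))
             (\<Prod>i=1..n. 1 - fps_X ^ (4 * i))"
proof -
  have "{1..4*n} \<inter> {i. [i = 0] (mod 4)} = (\<lambda>i. 4 * Suc i) ` {..<n}"
  proof (intro equalityI subsetI)
    fix i assume i: "i \<in> {1..4*n} \<inter> {i. [i = 0] (mod 4)}"
    then obtain j where j: "i = 4 * j" by (auto simp: cong_def)
    with i obtain l where "j = Suc l" by (cases j) auto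
    with i j show "i \<in> (\<lambda>i. 4 * Suc i) ` {..<n}" by auto
  qed (auto simp: cong_def)
  then have "(\<Prod>i\<in>{1..4*n} \<inter> {i. [i = 0] (mod 4)}. 1 + fps_X ^ i :: int fps)
      = qpoch (- (fps_X ^ 4)) (fps_X ^ 4) n"
    by (simp add: prod.reindex inj_on_def qpoch_def power_mult[symmetric] power_add[symmetric])
  moreover have "(- (fps_X ^ 4)) * (fps_X ^ 4) ^ n = fps_X ^ Suc n * (- (fps_X ^ (3 * n + 3)) :: int fps)"
    by (simp add: power_mult[symmetric] power_add[symmetric] flip: power_Suc)
  ultimately show ?thesis
    using shanks_sum_cong_prod[of "- (fps_X ^ 4 :: int fps)" "fps_X ^ 4" n "- 1"]
    by (simp only: eq_upto_def gauss_squares_finite power_mult) (rule dvd_mult_left)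
qed

lemma theta_triangular_eq_upto:
  "eq_upto n ((\<Sum>k\<le>2*n. (- (fps_X\<^sup>2)) ^ (k * (k + 1) div 2))
               * (\<Prod>i\<in>{1..4*n} \<inter> {i. [i = 2] (mod 4)}. 1 + fps_X ^ i))
             (\<Prod>i=1..n. 1 - fps_X ^ (4 * i))"
proof -
  let ?y = "- (fps_X\<^sup>2) :: int fps"
  have y2: "?y\<^sup>2 = fps_X ^ 4" by (simp flip: power_mult)
  have "{1..4*n} \<inter> {i. [i = 2] (mod 4)} = (\<lambda>i. 4 * i + 2) ` {..<n}"
  proof (intro equalityI subsetI)
    fix i assume i: "i \<in> {1..4*n} \<inter> {i. [i = 2] (mod 4)}"
    then have "i = 4 * (i div 4) + 2" by (auto simp: cong_def) presburger
    moreover from this i have "i div 4 < n" by auto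
    ultimately show "i \<in> (\<lambda>i. 4 * i + 2) ` {..<n}" by blast
  next
    fix i assume "i \<in> (\<lambda>i. 4 * i + 2) ` {..<n}"
    then obtain j where "i = 4 * j + 2" "j < n" by auto
    moreover have "(4 * j + 2) mod 4 = 2" by presburger
    ultimately show "i \<in> {1..4*n} \<inter> {i. [i = 2] (mod 4)}" by (simp add: cong_def)
  qed
  then have "(\<Prod>i\<in>{1..4*n} \<inter> {i. [i = 2] (mod 4)}. 1 + fps_X ^ i :: int fps) = qpoch ?y (?y\<^sup>2) n"
    unfolding y2
    by (simp add: prod.reindex inj_on_def qpoch_def power_mult[symmetric] power_add[symmetric]
        add.commute del: power_Suc)
  moreover have "?y * (?y\<^sup>2) ^ n = fps_X ^ Suc n * (- (fps_X ^ (3 * n + 1)))"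
    unfolding y2 by (simp add: power_mult[symmetric] power_add[symmetric] flip: power_Suc)
  moreover have "?y * (?y\<^sup>2) ^ n dvd shanks_sum ?y ?y (?y\<^sup>2) n - (\<Prod>i=1..n. 1 - (?y\<^sup>2) ^ i)"
    by (rule shanks_sum_cong_prod)
  ultimately show ?thesis
    unfolding eq_upto_def power_mult y2[symmetric]
    by (simp only: gauss_triangular_finite) (rule dvd_mult_left)
qed

section \<open>Comparing coefficients\<close>

lemma pod_gf_mult_nth:
  "(pod_gf * (of_int c * fps_X ^ m)) $ n = c * int (pod (int n - int m))"
proof -
  have "pod_gf * (of_int c * fps_X ^ m) = of_int c * (pod_gf * fps_X ^ m)" by (simp add: mult_ac)
  also have "\<dots> $ n = c * (pod_gf * fps_X ^ m) $ n"
    by (simp add: fps_of_int[symmetric])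
  finally show ?thesis
    by (auto simp: fps_X_power_mult_right_nth pod_gf_def pod_def nat_diff_distrib)
qed

theorem theorem1p3:
  fixes n :: nat
  shows "int (Q 0 n) =
      int (pod (int n)) + 2 * (\<Sum>\<^sub>\<infinity>k\<in>{1..}. (-1) ^ k * int (pod (int n - 4 * (int k)\<^sup>2)))
    \<and> int (Q 2 n) =
      (\<Sum>\<^sub>\<infinity>k\<in>{0..}. (-1) ^ (k * (k + 1) div 2) * int (pod (int n - int k * (int k + 1))))"
proof
  have "int (Q 0 n) = (pod_gf * (1 + 2 * (\<Sum>k=1..n. (-1) ^ k * (fps_X ^ 4) ^ k\<^sup>2))) $ n"
    using Q_gf_eq_pod_gf_mult[OF theta_squares_eq_upto, of n] by (simp add: eq_upto_iff Q_gf_def)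
  also have "pod_gf * (1 + 2 * (\<Sum>k=1..n. (-1) ^ k * (fps_X ^ 4) ^ k\<^sup>2))
      = pod_gf + (\<Sum>k=1..n. pod_gf * (of_int (2 * (-1) ^ k) * fps_X ^ (4 * k\<^sup>2)))"
    by (simp add: distrib_left sum_distrib_left power_mult mult_ac)
  also have "\<dots> $ n = int (pod (int n)) + 2 * (\<Sum>k=1..n. (-1) ^ k * int (pod (int n - 4 * (int k)\<^sup>2)))"
    unfolding fps_add_nth fps_sum_nth pod_gf_mult_nth
    by (simp add: pod_gf_def sum_distrib_left mult.assoc)
  also have "(\<Sum>k=1..n. (-1) ^ k * int (pod (int n - 4 * (int k)\<^sup>2)))
      = (\<Sum>\<^sub>\<infinity>k\<in>{1..n}. (-1) ^ k * int (pod (int n - 4 * (int k)\<^sup>2)))"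
    by simp
  also have "\<dots> = (\<Sum>\<^sub>\<infinity>k\<in>{1..}. (-1) ^ k * int (pod (int n - 4 * (int k)\<^sup>2)))"
  proof (rule infsum_cong_neutral)
    \<comment> \<open>For \<open>k > n\<close> the argument of \<open>pod\<close> is negative.\<close>
    fix k assume "k \<in> {1..} - {1..n}"
    then have "int n < int k" by auto
    also have "int k \<le> int k * int k" using \<open>k \<in> _\<close> by (cases k) auto
    finally show "(-1) ^ k * int (pod (int n - 4 * (int k)\<^sup>2)) = 0"
      by (simp add: pod_def power2_eq_square)
  qed auto
  finally show "int (Q 0 n) =
      int (pod (int n)) + 2 * (\<Sum>\<^sub>\<infinity>k\<in>{1..}. (-1) ^ k * int (pod (int n - 4 * (int k)\<^sup>2)))" .
next
  have pw: "(- (fps_X\<^sup>2)) ^ (k * (k + 1) div 2)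
      = of_int ((-1) ^ (k * (k + 1) div 2)) * (fps_X ^ (k * (k + 1)) :: int fps)" for k
    unfolding power_minus[of "fps_X\<^sup>2"] power_mult[symmetric] by simp
  have "int (Q 2 n) = (pod_gf * (\<Sum>k\<le>2*n. (- (fps_X\<^sup>2)) ^ (k * (k + 1) div 2))) $ n"
    using Q_gf_eq_pod_gf_mult[OF theta_triangular_eq_upto, of n] by (simp add: eq_upto_iff Q_gf_def)
  also have "\<dots> = (\<Sum>k\<le>2*n. (-1) ^ (k * (k + 1) div 2) * int (pod (int n - int k * (int k + 1))))"
    unfolding pw sum_distrib_left fps_sum_nth pod_gf_mult_nth by (simp add: algebra_simps)
  also have "\<dots> = (\<Sum>\<^sub>\<infinity>k\<in>{..2*n}. (-1) ^ (k * (k + 1) div 2) * int (pod (int n - int k * (int k + 1))))"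
    by simp
  also have "\<dots> = (\<Sum>\<^sub>\<infinity>k\<in>{0..}. (-1) ^ (k * (k + 1) div 2) * int (pod (int n - int k * (int k + 1))))"
  proof (rule infsum_cong_neutral)
    fix k :: nat assume "k \<in> {0..} - {..2*n}"
    then have "int n < int k" by auto
    also have "int k \<le> int k * (int k + 1)" by (simp add: distrib_left)
    finally show "(-1) ^ (k * (k + 1) div 2) * int (pod (int n - int k * (int k + 1))) = 0"
      by (simp add: pod_def)
  qed auto
  finally show "int (Q 2 n) =
      (\<Sum>\<^sub>\<infinity>k\<in>{0..}. (-1) ^ (k * (k + 1) div 2) * int (pod (int n - int k * (int k + 1))))" .
qed

end
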